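(* For any weighted cycles $(C^{(1)},\mathbf{w}_1),\dots,(C^{(k)},\mathbf{w}_k)$ (each with at least $3$ vertices), $\beta\big(\square_{i=1}^{k} C^{(i)},\square_{i=1}^{k}\mathbf{w}_i\big)=\sum_{i=1}^{k}\beta(C^{(i)},\mathbf{w}_i)$.
   Context: A weighted graph is a finite simple graph with positive integer edge weights that is weight-minimal: every edge is a shortest path between its endpoints. $d_\mathbf{w}$ is the weighted shortest-path distance. For a positive integer $\lambda$, $c_\lambda(G,\mathbf{w})$ is the minimum $m$ such that there is $f:V(G)\to\{0,1\}^m$ with $\lambda\, d_\mathbf{w}(u,v)\le d_H(f(u),f(v))$ for all $u,v$ ($d_H$ Hamming distance), and $\beta(G,\mathbf{w}):=\lim_{\lambda\to\infty}c_\lambda(G,\mathbf{w})/\lambda$ (this limit exists). The weighted Cartesian product $(G_1\square G_2,\mathbf{w}_1\square\mathbf{w}_2)$ has vertex set $V(G_1)\times V(G_2)$; $(u,x)$ and $(v,x)$ are joined by an edge of weight $\mathbf{w}_1(uv)$ when $uv\in E(G_1)$, and $(u,x)$ and $(u,y)$ by an edge of weight $\mathbf{w}_2(xy)$ when $xy\in E(G_2)$; iterated products are defined analogously. *)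

theory Defs
  imports Complex_Main "Graph_Theory.Graph_Theory"
begin

text \<open>A finite simple graph is a \<^locale>\<open>pair_graph\<close>: a finite, loop-free, symmetric relation on a
  finite vertex set, each undirected edge being represented by its two arcs. Edge weights are
  positive integers on arcs that agree on the two arcs of an edge; values outside the arc set are
  irrelevant. Distances are extended reals, infinite for vertices in different components.\<close>

definition wdist :: "'a pair_pre_digraph \<Rightarrow> ('a \<times> 'a \<Rightarrow> nat) \<Rightarrow> 'a \<Rightarrow> 'a \<Rightarrow> ereal" where
  "wdist G w u v = wf_digraph.\<mu> (with_proj G) (\<lambda>e. real (w e)) u v"

locale weighted_graph = pair_graph G for G :: "'a pair_pre_digraph" +
  fixes w :: "'a \<times> 'a \<Rightarrow> nat"
  assumes weight_sym: "(u, v) \<in> parcs G \<Longrightarrow> w (u, v) = w (v, u)"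
    and weight_pos: "e \<in> parcs G \<Longrightarrow> 0 < w e"
    and weight_minimal: "(u, v) \<in> parcs G \<Longrightarrow> wdist G w u v = ereal (real (w (u, v)))"

definition cycle_graph :: "'a pair_pre_digraph \<Rightarrow> bool" where
  "cycle_graph G \<longleftrightarrow>
     (\<exists>vs. distinct vs \<and> 3 \<le> length vs \<and> pverts G = set vs \<and>
        parcs G = (\<Union>i<length vs. {(vs ! i, vs ! (Suc i mod length vs)),
                                 (vs ! (Suc i mod length vs), vs ! i)}))"

definition weighted_cycle :: "'a pair_pre_digraph \<Rightarrow> ('a \<times> 'a \<Rightarrow> nat) \<Rightarrow> bool" where
  "weighted_cycle G w \<longleftrightarrow> weighted_graph G w \<and> cycle_graph G"

definition hamming_dist :: "bool list \<Rightarrow> bool list \<Rightarrow> nat" where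
  "hamming_dist x y = card {i. i < length x \<and> x ! i \<noteq> y ! i}"

text \<open>Applied only to words of equal length. For a finite connected graph the \<open>LEAST\<close> below ranges
  over a nonempty set, and the limit in \<open>graph_beta\<close> exists.\<close>

definition code_length :: "nat \<Rightarrow> 'a pair_pre_digraph \<Rightarrow> ('a \<times> 'a \<Rightarrow> nat) \<Rightarrow> nat" where
  "code_length l G w =
     (LEAST m. \<exists>f. (\<forall>u\<in>pverts G. length (f u) = m) \<and>
        (\<forall>u\<in>pverts G. \<forall>v\<in>pverts G.
           ereal (real l) * wdist G w u v \<le> ereal (real (hamming_dist (f u) (f v)))))"

definition graph_beta :: "'a pair_pre_digraph \<Rightarrow> ('a \<times> 'a \<Rightarrow> nat) \<Rightarrow> real" where
  "graph_beta G w = lim (\<lambda>l. real (code_length l G w) / real l)"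

text \<open>The product of a family of graphs indexed by \<open>I\<close>: vertices are the (extensional) tuples, and an
  arc changes exactly one coordinate, along an arc of the corresponding factor, whose weight it
  inherits.\<close>

definition cart_prod :: "'i set \<Rightarrow> ('i \<Rightarrow> 'a pair_pre_digraph) \<Rightarrow> ('i \<Rightarrow> 'a) pair_pre_digraph" where
  "cart_prod I G =
     \<lparr>pverts = (\<Pi>\<^sub>E i\<in>I. pverts (G i)),
      parcs = {(x, y). x \<in> (\<Pi>\<^sub>E i\<in>I. pverts (G i)) \<and> y \<in> (\<Pi>\<^sub>E i\<in>I. pverts (G i)) \<and>
                 (\<exists>i\<in>I. (x i, y i) \<in> parcs (G i) \<and> (\<forall>j\<in>I - {i}. x j = y j))}\<rparr>"

definition cart_prod_weight ::
  "'i set \<Rightarrow> ('i \<Rightarrow> 'a \<times> 'a \<Rightarrow> nat) \<Rightarrow> ('i \<Rightarrow> 'a) \<times> ('i \<Rightarrow> 'a) \<Rightarrow> nat" where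
  "cart_prod_weight I w = (\<lambda>(x, y). let i = (THE i. i \<in> I \<and> x i \<noteq> y i) in w i (x i, y i))"

end

theory Submission
  imports Defs
begin

text \<open>A weighted cycle of perimeter \<open>L\<close> has \<open>\<beta> = L / 2\<close>, and a product of weighted cycles has half
  the sum of the perimeters. Upper bound: the half-circle cuts embed a circle of even length \<open>2 * m\<close>
  isometrically into the \<open>m\<close>-cube, and codes of the factors are concatenated. Lower bound: by weight
  minimality no edge is longer than \<open>L / 2\<close>, so every cycle contains three vertices whose mutual
  distances add up to \<open>L\<close>; choosing such a triangle in each factor yields a diagonal triangle in the
  product, and any three words of length \<open>m\<close> have mutual Hamming distances adding up to at most
  \<open>2 * m\<close>.\<close>

section \<open>Distance functions of weighted digraphs\<close>

text \<open>Costs of walks as natural numbers, in a form that supports concatenation and reversal by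
  rule induction. The arc lists of the library are met again only in
  \<open>wdist_eq_distance_fun\<close>.\<close>

inductive walk_cost :: "'a pair_pre_digraph \<Rightarrow> ('a \<times> 'a \<Rightarrow> nat) \<Rightarrow> 'a \<Rightarrow> 'a \<Rightarrow> nat \<Rightarrow> bool"
  for G w where
  refl: "u \<in> pverts G \<Longrightarrow> walk_cost G w u u 0"
| step: "(u, v) \<in> parcs G \<Longrightarrow> walk_cost G w v t n \<Longrightarrow> walk_cost G w u t (w (u, v) + n)"

lemma walk_cost_trans:
  assumes "walk_cost G w u v m" and "walk_cost G w v t n"
  shows "walk_cost G w u t (m + n)"
  using assms by (induction rule: walk_cost.induct) (auto simp: add.assoc intro: walk_cost.step)

lemma (in pair_wf_digraph) walk_cost_arc:
  "(u, v) \<in> parcs G \<Longrightarrow> walk_cost G w u v (w (u, v))"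
  using walk_cost.step[OF _ walk_cost.refl, of u v G w] in_arcsD2 by auto

lemma (in weighted_graph) walk_cost_sym:
  "walk_cost G w u v n \<Longrightarrow> walk_cost G w v u n"
proof (induction rule: walk_cost.induct)
  case (step u v t n)
  have "walk_cost G w v u (w (v, u))"
    by (rule walk_cost_arc[OF arcs_symmetric[OF step.hyps(1)]])
  then show ?case
    using walk_cost_trans[OF step.IH] step.hyps(1) weight_sym by (metis add.commute)
qed (rule walk_cost.refl)

text \<open>Walks bound the distance from above; the Lipschitz condition on arcs makes every \<open>D a\<close> a
  potential, which bounds it from below.\<close>
definition distance_fun ::
  "'a pair_pre_digraph \<Rightarrow> ('a \<times> 'a \<Rightarrow> nat) \<Rightarrow> ('a \<Rightarrow> 'a \<Rightarrow> nat) \<Rightarrow> bool" where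
  "distance_fun G w D \<longleftrightarrow> pair_wf_digraph G \<and>
     (\<forall>u\<in>pverts G. D u u = 0) \<and>
     (\<forall>u\<in>pverts G. \<forall>v\<in>pverts G. walk_cost G w u v (D u v)) \<and>
     (\<forall>a\<in>pverts G. \<forall>u v. (u, v) \<in> parcs G \<longrightarrow> D a v \<le> D a u + w (u, v))"

text \<open>A walk of cost \<open>D u v\<close> exists, and summing the Lipschitz inequalities of
  \<open>D u\<close> along an arbitrary walk from \<open>u\<close> to \<open>v\<close> shows that
  none is cheaper.\<close>

lemma wdist_eq_distance_fun:
  assumes D: "distance_fun G w D" and "u \<in> pverts G" "v \<in> pverts G"
  shows "wdist G w u v = ereal (real (D u v))"
proof -
  interpret pair_wf_digraph G
    using D by (simp add: distance_fun_def)
  have upper: "\<exists>p. awalk s p t \<and> awalk_cost (\<lambda>e. real (w e)) p = real n"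
    if "walk_cost G w s t n" for s t n
    using that
  proof (induction rule: walk_cost.induct)
    case (refl s)
    then show ?case by (intro exI[of _ "[]"]) (simp add: awalk_Nil_iff)
  next
    case (step s r t n)
    then obtain p where "awalk r p t" "awalk_cost (\<lambda>e. real (w e)) p = real n" by blast
    with step.hyps(1) show ?case
      by (intro exI[of _ "(s, r) # p"]) (auto simp: awalk_Cons_iff intro: in_arcsD1)
  qed
  \<comment> \<open>The start \<open>s\<close> varies so that induction on the arc list applies; at
    \<open>s = u\<close> the term \<open>D u s\<close> vanishes.\<close>
  have lower: "real (D u v) \<le> real (D u s) + awalk_cost (\<lambda>e. real (w e)) p"
    if "awalk s p v" for s p
    using that
  proof (induction p arbitrary: s)
    case Nil
    then show ?case by (simp add: awalk_Nil_iff)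
  next
    case (Cons e p)
    then have e: "e \<in> parcs G" "fst e = s" and "awalk (snd e) p v"
      by (auto simp: awalk_Cons_iff)
    then have "real (D u v) \<le> real (D u (snd e)) + awalk_cost (\<lambda>e. real (w e)) p"
      using Cons.IH by blast
    moreover have "D u (snd e) \<le> D u s + w e"
      using D e assms(2) unfolding distance_fun_def by (metis prod.collapse)
    ultimately show ?case by simp
  qed
  obtain p where "awalk u p v" "awalk_cost (\<lambda>e. real (w e)) p = real (D u v)"
    using upper D assms(2,3) unfolding distance_fun_def by blast
  then have "wdist G w u v \<le> ereal (real (D u v))"
    unfolding wdist_def using min_cost_le_walk_cost by metis
  moreover have "ereal (real (D u v)) \<le> wdist G w u v"
    unfolding wdist_def \<mu>_def using lower[of u] D assms(2)
    by (intro INF_greatest) (simp add: distance_fun_def)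
  ultimately show ?thesis by simp
qed

section \<open>Embeddings into Hamming cubes\<close>

lemma hamming_dist_append:
  assumes "length x = length x'"
  shows "hamming_dist (x @ y) (x' @ y') = hamming_dist x x' + hamming_dist y y'"
proof -
  let ?A = "{i. i < length x \<and> x ! i \<noteq> x' ! i}"
  let ?B = "{i. i < length y \<and> y ! i \<noteq> y' ! i}"
  have "{i. i < length (x @ y) \<and> (x @ y) ! i \<noteq> (x' @ y') ! i} = ?A \<union> (+) (length x) ` ?B"
    (is "?L = ?R")
  proof (intro set_eqI)
    fix i
    show "i \<in> ?L \<longleftrightarrow> i \<in> ?R"
    proof (cases "i < length x")
      case False
      then obtain j where "i = length x + j" using le_Suc_ex not_less by blast
      then show ?thesis using assms by (auto simp: nth_append)
    qed (use assms in \<open>auto simp: nth_append\<close>)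
  qed
  moreover have "card (?A \<union> (+) (length x) ` ?B) = card ?A + card ((+) (length x) ` ?B)"
    by (intro card_Un_disjoint) auto
  moreover have "card ((+) (length x) ` ?B) = card ?B"
    by (intro card_image) auto
  ultimately show ?thesis by (simp add: hamming_dist_def)
qed

text \<open>A position takes only two values, so it separates at most two of the three pairs.\<close>
lemma hamming_dist_triangle_perimeter:
  assumes "length x = m" "length y = m" "length z = m"
  shows "hamming_dist x y + hamming_dist y z + hamming_dist z x \<le> 2 * m"
proof -
  have card_sum: "card {i. i < m \<and> P i} = (\<Sum>i<m. if P i then 1 else 0)" for P
    by (simp add: sum.If_cases Int_def lessThan_def)
  have "hamming_dist x y + hamming_dist y z + hamming_dist z x
      = (\<Sum>i<m. (if x ! i \<noteq> y ! i then 1 else 0) + (if y ! i \<noteq> z ! i then 1 else 0)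
           + (if z ! i \<noteq> x ! i then 1 else 0))"
    using assms by (simp only: hamming_dist_def card_sum sum.distrib)
  also have "\<dots> \<le> (\<Sum>i<m. 2)"
    by (intro sum_mono) auto
  finally show ?thesis by simp
qed

text \<open>The condition minimised in \<open>code_length\<close>, with the scaled distance
  \<open>l * D u v\<close> replaced by an arbitrary natural-valued \<open>d\<close>, so that codes
  can be combined factor by factor.\<close>

definition embeddable :: "'a set \<Rightarrow> ('a \<Rightarrow> 'a \<Rightarrow> nat) \<Rightarrow> nat \<Rightarrow> bool" where
  "embeddable V d m \<longleftrightarrow> (\<exists>f. (\<forall>u\<in>V. length (f u) = m) \<and>
     (\<forall>u\<in>V. \<forall>v\<in>V. d u v \<le> hamming_dist (f u) (f v)))"

lemma code_length_eq_embeddable: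
  assumes "distance_fun G w D"
  shows "code_length l G w = (LEAST m. embeddable (pverts G) (\<lambda>u v. l * D u v) m)"
proof -
  have "(\<forall>u\<in>pverts G. \<forall>v\<in>pverts G.
           ereal (real l) * wdist G w u v \<le> ereal (real (hamming_dist (f u) (f v))))
    \<longleftrightarrow> (\<forall>u\<in>pverts G. \<forall>v\<in>pverts G. l * D u v \<le> hamming_dist (f u) (f v))" for f
    using wdist_eq_distance_fun[OF assms]
    by (simp flip: of_nat_mult)
  then show ?thesis
    unfolding code_length_def embeddable_def by simp
qed

lemma embeddable_prod:
  assumes "finite I" and "\<And>i. i \<in> I \<Longrightarrow> embeddable (V i) (d i) (m i)"
  shows "embeddable (\<Pi>\<^sub>E i\<in>I. V i) (\<lambda>x y. \<Sum>i\<in>I. d i (x i) (y i)) (\<Sum>i\<in>I. m i)"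
proof -
  obtain f where f: "\<And>i u. i \<in> I \<Longrightarrow> u \<in> V i \<Longrightarrow> length (f i u) = m i"
    "\<And>i u v. i \<in> I \<Longrightarrow> u \<in> V i \<Longrightarrow> v \<in> V i \<Longrightarrow> d i u v \<le> hamming_dist (f i u) (f i v)"
    using assms(2) unfolding embeddable_def by metis
  \<comment> \<open>Only the set \<open>J\<close> of summed coordinates grows in the induction; the
    words are always assigned to tuples over all of \<open>I\<close>.\<close>
  have "\<exists>g. (\<forall>x\<in>(\<Pi>\<^sub>E i\<in>I. V i). length (g x) = (\<Sum>i\<in>J. m i)) \<and>
      (\<forall>x\<in>(\<Pi>\<^sub>E i\<in>I. V i). \<forall>y\<in>(\<Pi>\<^sub>E i\<in>I. V i).
         (\<Sum>i\<in>J. d i (x i) (y i)) \<le> hamming_dist (g x) (g y))"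
    if "finite J" "J \<subseteq> I" for J
    using that
  proof (induction rule: finite_induct)
    case empty
    show ?case by (intro exI[of _ "\<lambda>_. []"]) simp
  next
    case (insert j J)
    then obtain g where g:
      "\<forall>x\<in>(\<Pi>\<^sub>E i\<in>I. V i). length (g x) = (\<Sum>i\<in>J. m i)"
      "\<forall>x\<in>(\<Pi>\<^sub>E i\<in>I. V i). \<forall>y\<in>(\<Pi>\<^sub>E i\<in>I. V i).
         (\<Sum>i\<in>J. d i (x i) (y i)) \<le> hamming_dist (g x) (g y)"
      by auto
    have j: "j \<in> I" using insert.prems by simp
    show ?case
      using insert.hyps g f[OF j] PiE_mem[OF _ j, of _ V]
      by (intro exI[of _ "\<lambda>x. f j (x j) @ g x"])
        (simp add: hamming_dist_append add_mono)
  qed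
  from this[OF assms(1) subset_refl] show ?thesis
    unfolding embeddable_def .
qed

text \<open>The triangle \<open>a\<close>, \<open>b\<close>, \<open>c\<close> forces
  \<open>l * L \<le> 2 * c' l\<close>, and the embeddings give
  \<open>2 * c' l \<le> l * L + K\<close>. The overhead \<open>K\<close> does not depend on
  \<open>l\<close>, so it disappears after division by \<open>l\<close>.\<close>

lemma graph_beta_eq:
  assumes D: "distance_fun G w D"
    and V: "a \<in> pverts G" "b \<in> pverts G" "c \<in> pverts G"
    and perimeter: "L \<le> D a b + D b c + D c a"
    and emb: "\<And>l. \<exists>m. 2 * m \<le> l * L + K \<and> embeddable (pverts G) (\<lambda>u v. l * D u v) m"
  shows "graph_beta G w = real L / 2"
proof -
  define c' where "c' l = code_length l G w" for l
  have c': "c' l = (LEAST m. embeddable (pverts G) (\<lambda>u v. l * D u v) m)" for l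
    unfolding c'_def by (rule code_length_eq_embeddable[OF D])
  have upper: "2 * c' l \<le> l * L + K" for l
    using emb[of l] Least_le[of "embeddable (pverts G) (\<lambda>u v. l * D u v)"]
    unfolding c' by fastforce
  have lower: "l * L \<le> 2 * c' l" for l
  proof -
    have "embeddable (pverts G) (\<lambda>u v. l * D u v) (c' l)"
      \<comment> \<open>The embeddings assumed in \<open>emb\<close> also guarantee that the minimum
        is attained.\<close>
      unfolding c' using emb[of l] LeastI_ex[of "embeddable (pverts G) (\<lambda>u v. l * D u v)"] by blast
    then obtain f where f: "\<forall>u\<in>pverts G. length (f u) = c' l"
      "\<forall>u\<in>pverts G. \<forall>v\<in>pverts G. l * D u v \<le> hamming_dist (f u) (f v)"
      unfolding embeddable_def by blast
    have "l * L \<le> l * (D a b + D b c + D c a)"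
      using perimeter by simp
    also have "\<dots> \<le> hamming_dist (f a) (f b) + hamming_dist (f b) (f c) + hamming_dist (f c) (f a)"
      using f(2) V by (simp add: distrib_left add_mono)
    also have "\<dots> \<le> 2 * c' l"
      using f(1) V by (intro hamming_dist_triangle_perimeter) auto
    finally show ?thesis .
  qed
  have "(\<lambda>l. real L / 2 + real K / 2 * inverse (real l)) \<longlonglongrightarrow> real L / 2 + real K / 2 * 0"
    by (intro tendsto_intros lim_inverse_n)
  then have lim: "(\<lambda>l. real L / 2 + real K / 2 * inverse (real l)) \<longlonglongrightarrow> real L / 2" by simp
  have "(\<lambda>l. real (c' l) / real l) \<longlonglongrightarrow> real L / 2"
  proof (rule tendsto_sandwich[OF _ _ tendsto_const lim]; rule eventually_sequentiallyI[of 1])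
    fix l :: nat assume "1 \<le> l"
    then have l: "0 < real l" by simp
    have "real l * real L \<le> 2 * real (c' l)" "2 * real (c' l) \<le> real l * real L + real K"
      using of_nat_mono[OF lower[of l], where 'a=real] of_nat_mono[OF upper[of l], where 'a=real]
      by simp_all
    with l show "real L / 2 \<le> real (c' l) / real l"
      and "real (c' l) / real l \<le> real L / 2 + real K / 2 * inverse (real l)"
      by (simp_all add: field_simps)
  qed
  then show ?thesis
    unfolding graph_beta_def c'_def by (rule limI)
qed

section \<open>Cartesian products\<close>

lemma cart_prod_weight_eq:
  assumes "i \<in> I" "x i \<noteq> y i" "\<forall>j\<in>I - {i}. x j = y j"
  shows "cart_prod_weight I w (x, y) = w i (x i, y i)"
proof -
  have "(THE i. i \<in> I \<and> x i \<noteq> y i) = i"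
    using assms by (intro the_equality) auto
  then show ?thesis by (simp add: cart_prod_weight_def)
qed

text \<open>A walk in one factor lifts to the product with the other coordinates frozen at
  \<open>x\<close>. Since factors have no loops, each lifted arc really changes coordinate
  \<open>i\<close>, which lets \<open>cart_prod_weight\<close> recover \<open>i\<close>.\<close>

lemma walk_cost_cart_prod_update:
  assumes G: "\<And>i. i \<in> I \<Longrightarrow> pair_loopfree_digraph (G i)"
    and i: "i \<in> I" and w: "walk_cost (G i) (w i) u v n"
    and x: "x \<in> (\<Pi>\<^sub>E i\<in>I. pverts (G i))"
  shows "walk_cost (cart_prod I G) (cart_prod_weight I w) (x(i := u)) (x(i := v)) n"
  using w
proof (induction rule: walk_cost.induct)
  case (refl u)
  have "x(i := u) \<in> (\<Pi>\<^sub>E i\<in>I. pverts (G i))"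
    using i x refl by (auto simp: PiE_iff extensional_def)
  moreover have "pverts (cart_prod I G) = (\<Pi>\<^sub>E i\<in>I. pverts (G i))"
    by (simp add: cart_prod_def)
  ultimately show ?case by (metis walk_cost.refl)
next
  case (step u v t n)
  interpret pair_loopfree_digraph "G i" using G i .
  have uv: "u \<in> pverts (G i)" "v \<in> pverts (G i)" "u \<noteq> v"
    using in_arcsD1 in_arcsD2 pair_no_loops[OF step.hyps(1)] step.hyps(1) by auto
  have "(x(i := u), x(i := v)) \<in> parcs (cart_prod I G)"
    using i x uv step.hyps(1) by (fastforce simp: cart_prod_def PiE_iff extensional_def)
  moreover have "cart_prod_weight I w (x(i := u), x(i := v)) = w i (u, v)"
    using i uv by (subst cart_prod_weight_eq[of i]) auto
  ultimately show ?case
    using walk_cost.step step.IH by metis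
qed

text \<open>Changing the coordinates one after another yields a walk whose cost is the sum;
  conversely, an arc affects a single summand, so the Lipschitz condition is inherited from that
  factor.\<close>

lemma distance_fun_cart_prod:
  assumes "finite I" and G: "\<And>i. i \<in> I \<Longrightarrow> pair_loopfree_digraph (G i)"
    and D: "\<And>i. i \<in> I \<Longrightarrow> distance_fun (G i) (w i) (D i)"
  shows "distance_fun (cart_prod I G) (cart_prod_weight I w) (\<lambda>x y. \<Sum>i\<in>I. D i (x i) (y i))"
  unfolding distance_fun_def
proof (intro conjI ballI allI impI)
  let ?P = "\<Pi>\<^sub>E i\<in>I. pverts (G i)"
  have V: "pverts (cart_prod I G) = ?P"
    by (simp add: cart_prod_def)
  show "pair_wf_digraph (cart_prod I G)"
    by unfold_locales (auto simp: cart_prod_def)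
  show "(\<Sum>i\<in>I. D i (x i) (x i)) = 0" if "x \<in> pverts (cart_prod I G)" for x
    using that D unfolding V distance_fun_def by (auto simp: PiE_iff)
  show "walk_cost (cart_prod I G) (cart_prod_weight I w) x y (\<Sum>i\<in>I. D i (x i) (y i))"
    if "x \<in> pverts (cart_prod I G)" "y \<in> pverts (cart_prod I G)" for x y
  proof -
    have xy: "x \<in> ?P" "y \<in> ?P" using that by (simp_all add: V)
    \<comment> \<open>Hybrid tuples: the coordinates in \<open>J\<close> have already been moved
      from \<open>x\<close> to \<open>y\<close>.\<close>
    have mem: "(\<lambda>i. if i \<in> J then y i else x i) \<in> ?P" if "J \<subseteq> I" for J
      using xy that by (auto simp: PiE_iff extensional_def)
    have "walk_cost (cart_prod I G) (cart_prod_weight I w) x (\<lambda>i. if i \<in> J then y i else x i)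
        (\<Sum>i\<in>J. D i (x i) (y i))" if "finite J" "J \<subseteq> I" for J
      using that
    proof (induction rule: finite_induct)
      case empty
      show ?case using xy(1) by (simp add: walk_cost.refl V)
    next
      case (insert j J)
      let ?z = "\<lambda>i. if i \<in> J then y i else x i"
      have j: "j \<in> I" "J \<subseteq> I" using insert.prems by auto
      have "walk_cost (G j) (w j) (x j) (y j) (D j (x j) (y j))"
        using D[OF j(1)] PiE_mem[OF xy(1) j(1)] PiE_mem[OF xy(2) j(1)]
        by (simp add: distance_fun_def)
      then have "walk_cost (cart_prod I G) (cart_prod_weight I w) (?z(j := x j)) (?z(j := y j))
          (D j (x j) (y j))"
        using walk_cost_cart_prod_update[OF G j(1) _ mem[OF j(2)]] by blast
      moreover have "?z(j := x j) = ?z" "?z(j := y j) = (\<lambda>i. if i \<in> insert j J then y i else x i)"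
        using insert.hyps by auto
      ultimately show ?case
        using walk_cost_trans[OF insert.IH[OF j(2)]] insert.hyps by (simp add: add.commute)
    qed
    moreover have "(\<lambda>i. if i \<in> I then y i else x i) = y"
      using xy by (auto simp: PiE_iff extensional_def)
    ultimately show ?thesis
      using assms(1) by fastforce
  qed
  show "(\<Sum>i\<in>I. D i (a i) (y i)) \<le> (\<Sum>i\<in>I. D i (a i) (x i)) + cart_prod_weight I w (x, y)"
    if a: "a \<in> pverts (cart_prod I G)" and arc: "(x, y) \<in> parcs (cart_prod I G)" for a x y
  proof -
    obtain i where i: "i \<in> I" "(x i, y i) \<in> parcs (G i)" "\<forall>j\<in>I - {i}. x j = y j"
      using arc by (auto simp: cart_prod_def)
    interpret pair_loopfree_digraph "G i" using G i(1) .
    have wi: "cart_prod_weight I w (x, y) = w i (x i, y i)"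
      using i pair_no_loops[OF i(2)] by (intro cart_prod_weight_eq) auto
    have "a i \<in> pverts (G i)" using a i(1) by (auto simp: V)
    then have "D i (a i) (y i) \<le> D i (a i) (x i) + w i (x i, y i)"
      using D[OF i(1)] i(2) by (simp add: distance_fun_def)
    moreover have "(\<Sum>j\<in>I - {i}. D j (a j) (y j)) = (\<Sum>j\<in>I - {i}. D j (a j) (x j))"
      using i(3) by (intro sum.cong) auto
    ultimately show ?thesis
      using assms(1) i(1) by (simp add: sum.remove wi)
  qed
qed

section \<open>Weighted cycles\<close>

text \<open>The shorter arc between two points of a circle of length \<open>L\<close>, given by
  coordinates in \<open>{0..L}\<close>; the coordinates \<open>0\<close> and \<open>L\<close> denote
  the same point.\<close>

definition circ_dist :: "nat \<Rightarrow> nat \<Rightarrow> nat \<Rightarrow> nat" where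
  "circ_dist L x y = (let d = max x y - min x y in min d (L - d))"

lemma circ_dist_zero: "x \<le> L \<Longrightarrow> circ_dist L x 0 = circ_dist L x L"
  by (simp add: circ_dist_def min.commute)

text \<open>The two inequalities serve the two orientations of an edge of length
  \<open>k\<close>.\<close>

lemma circ_dist_add_le:
  assumes "y + k \<le> L" "x \<le> L"
  shows "circ_dist L x (y + k) \<le> circ_dist L x y + k"
    and "circ_dist L x y \<le> circ_dist L x (y + k) + k"
  using assms unfolding circ_dist_def Let_def by linarith+

text \<open>Bit \<open>j\<close> tells on which side of the diameter of the circle of length \<open>2 * m\<close> through \<open>j\<close> and
  \<open>j + m\<close> the point \<open>x\<close> lies.\<close>
definition circ_code :: "nat \<Rightarrow> nat \<Rightarrow> bool list" where
  "circ_code m x = map (\<lambda>j. j < x \<and> x \<le> j + m) [0..<m]"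

lemma circ_dist_le_hamming_dist:
  assumes "x \<le> 2 * m" "y \<le> 2 * m"
  shows "circ_dist (2 * m) x y \<le> hamming_dist (circ_code m x) (circ_code m y)"
proof -
  have sym: "hamming_dist (circ_code m y) (circ_code m x) = hamming_dist (circ_code m x) (circ_code m y)"
    for x y
    unfolding hamming_dist_def circ_code_def by (intro arg_cong[of _ _ card]) auto
  have csym: "circ_dist (2 * m) x y = circ_dist (2 * m) y x" for x y
    by (simp add: circ_dist_def max.commute min.commute)
  have le: "circ_dist (2 * m) x y \<le> hamming_dist (circ_code m x) (circ_code m y)"
    if "x \<le> y" "y \<le> 2 * m" for x y
  proof -
    let ?S = "{j. j < m \<and> (j < x \<and> x \<le> j + m) \<noteq> (j < y \<and> y \<le> j + m)}"
    have S: "hamming_dist (circ_code m x) (circ_code m y) = card ?S"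
      unfolding hamming_dist_def circ_code_def by (intro arg_cong[of _ _ card]) auto
    \<comment> \<open>In the first two cases both points lie on the same half of the circle. In the
      other two they lie on different halves, and the shorter arc runs through \<open>m\<close> in
      the third case and through \<open>0\<close> in the fourth. The set \<open>T\<close> below has
      the length of the shorter arc as its size.\<close>
    consider "y \<le> m" | "m < x" | "x \<le> m" "m < y" "y - m \<le> x" | "x \<le> m" "m < y" "x < y - m"
      by linarith
    then have "\<exists>T. T \<subseteq> ?S \<and> circ_dist (2 * m) x y \<le> card T"
    proof cases
      case 1
      then show ?thesis using that
        by (intro exI[of _ "{x..<y}"]) (auto simp: circ_dist_def Let_def)
    next
      case 2
      then show ?thesis using that
        by (intro exI[of _ "{x - m..<y - m}"]) (auto simp: circ_dist_def Let_def)
    next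
      case 3
      have "card ({..<y - m} \<union> {x..<m}) = (y - m) + (m - x)"
        using 3 by (subst card_Un_disjoint) auto
      then show ?thesis using that 3
        by (intro exI[of _ "{..<y - m} \<union> {x..<m}"]) (auto simp: circ_dist_def Let_def)
    next
      case 4
      have "card ({..<x} \<union> {y - m..<m}) = x + (2 * m - y)"
        using 4 that by (subst card_Un_disjoint) auto
      then show ?thesis using that 4
        by (intro exI[of _ "{..<x} \<union> {y - m..<m}"]) (auto simp: circ_dist_def Let_def)
    qed
    then obtain T where "T \<subseteq> ?S" "circ_dist (2 * m) x y \<le> card T" by blast
    then show ?thesis
      unfolding S using card_mono[of ?S T] by simp
  qed
  show ?thesis
    using le[of x y] le[of y x] assms sym csym by (metis nat_le_linear)
qed

text \<open>The scaled circle has length \<open>l * L\<close>, which may be odd. Lengthening it to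
  the even number \<open>2 * m\<close> while keeping all coordinates shortens no distance and costs
  at most one unit.\<close>

lemma embeddable_circ_dist:
  assumes "\<And>u. u \<in> V \<Longrightarrow> q u \<le> L"
  shows "\<exists>m. 2 * m \<le> l * L + 1 \<and> embeddable V (\<lambda>u v. l * circ_dist L (q u) (q v)) m"
proof -
  define m where "m = (l * L + 1) div 2"
  have m: "2 * m \<le> l * L + 1" "l * L \<le> 2 * m" by (auto simp: m_def)
  have "l * circ_dist L x y \<le> hamming_dist (circ_code m (l * x)) (circ_code m (l * y))"
    if "x \<le> L" "y \<le> L" for x y
  proof -
    have "l * x \<le> l * L" "l * y \<le> l * L" using that by auto
    moreover have "l * circ_dist L x y = circ_dist (l * L) (l * x) (l * y)"
      by (simp only: circ_dist_def Let_def nat_mult_max_right nat_mult_min_right diff_mult_distrib2)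
    moreover have "circ_dist (l * L) (l * x) (l * y) \<le> circ_dist (2 * m) (l * x) (l * y)"
      unfolding circ_dist_def Let_def using m by (intro min.mono diff_le_mono) simp_all
    ultimately show ?thesis
      using circ_dist_le_hamming_dist[of "l * x" m "l * y"] m by linarith
  qed
  then have "embeddable V (\<lambda>u v. l * circ_dist L (q u) (q v)) m"
    unfolding embeddable_def using assms
    by (intro exI[of _ "\<lambda>u. circ_code m (l * q u)"]) (auto simp: circ_code_def)
  with m show ?thesis by blast
qed

text \<open>Partial sums of the weights place the vertices on a circle whose length \<open>L\<close>
  is the perimeter. Weight minimality enters through \<open>edge\<close>: no edge is longer than the
  rest of the cycle.\<close>

lemma weighted_cycle_distance_fun:
  assumes "weighted_cycle G w"
  obtains q L a b c where
    "distance_fun G w (\<lambda>u v. circ_dist L (q u) (q v))"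
    "\<And>u. u \<in> pverts G \<Longrightarrow> q u \<le> L"
    "a \<in> pverts G" "b \<in> pverts G" "c \<in> pverts G"
    "L \<le> circ_dist L (q a) (q b) + circ_dist L (q b) (q c) + circ_dist L (q c) (q a)"
proof -
  interpret weighted_graph G w
    using assms by (simp add: weighted_cycle_def)
  obtain vs where vs: "distinct vs" "3 \<le> length vs" "pverts G = set vs"
    and arcs: "parcs G = (\<Union>i<length vs. {(vs ! i, vs ! (Suc i mod length vs)),
                                 (vs ! (Suc i mod length vs), vs ! i)})"
    using assms unfolding weighted_cycle_def cycle_graph_def by blast
  define n where "n = length vs"
  define W where "W i = w (vs ! i, vs ! (Suc i mod n))" for i
  define p where "p j = (\<Sum>i<j. W i)" for j
  define L where "L = p n"
  define idx where "idx u = (THE i. i < n \<and> vs ! i = u)" for u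
  define q where "q u = p (idx u)" for u
  have n: "3 \<le> n" using vs by (simp add: n_def)
  have p_Suc: "p (Suc i) = p i + W i" for i by (simp add: p_def)
  have p_0: "p 0 = 0" by (simp add: p_def)
  have p_mono: "p i \<le> p j" if "i \<le> j" for i j
    unfolding p_def using that by (intro sum_mono2) auto
  have idx: "idx (vs ! i) = i" if "i < n" for i
    unfolding idx_def using that vs(1) by (intro the_equality) (auto simp: n_def nth_eq_iff_index_eq)
  have q_nth: "q (vs ! i) = p i" if "i < n" for i
    using that by (simp add: q_def idx)
  have vertexE: "\<exists>i<n. u = vs ! i" if "u \<in> pverts G" for u
    using that vs(3) by (auto simp: in_set_conv_nth n_def)
  have nth_mem: "vs ! i \<in> pverts G" if "i < n" for i
    using that vs(3) by (simp add: n_def)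
  have arc: "(vs ! i, vs ! (Suc i mod n)) \<in> parcs G" if "i < n" for i
    using that arcs by (auto simp: n_def)
  have arcE: "\<exists>i<n. (u, v) = (vs ! i, vs ! (Suc i mod n)) \<or> (u, v) = (vs ! (Suc i mod n), vs ! i)"
    if "(u, v) \<in> parcs G" for u v
    using that arcs by (auto simp: n_def)
  have q_le: "q u \<le> L" if "u \<in> pverts G" for u
    using vertexE[OF that] q_nth p_mono by (metis L_def less_imp_le)
  have q_next: "q (vs ! (Suc i mod n)) = (if Suc i = n then 0 else p i + W i)" if "i < n" for i
    using that q_nth[of "Suc i mod n"] by (simp add: mod_Suc p_0 p_Suc)

  \<comment> \<open>With \<open>j = n\<close> the walk returns to vertex \<open>0\<close> at
    coordinate \<open>L\<close>, which covers the closing edge.\<close>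
  have walk_up: "walk_cost G w (vs ! i) (vs ! (j mod n)) (p j - p i)" if "i \<le> j" "j \<le> n" "i < n" for i j
    using that
  proof (induction j rule: dec_induct)
    case base
    then show ?case by (simp add: walk_cost.refl nth_mem)
  next
    case (step j)
    then have "walk_cost G w (vs ! i) (vs ! j) (p j - p i)" by simp
    moreover have "walk_cost G w (vs ! j) (vs ! (Suc j mod n)) (W j)"
      unfolding W_def using step by (intro walk_cost_arc arc) simp
    ultimately have "walk_cost G w (vs ! i) (vs ! (Suc j mod n)) (p j - p i + W j)"
      by (rule walk_cost_trans)
    moreover have "p j - p i + W j = p (Suc j) - p i"
      using p_mono[OF step.hyps(1)] by (simp add: p_Suc)
    ultimately show ?case by simp
  qed
  have walk_le: "walk_cost G w (vs ! i) (vs ! j) (circ_dist L (p i) (p j))" if "i \<le> j" "j < n" for i j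
  proof -
    have one: "walk_cost G w (vs ! i) (vs ! j) (p j - p i)"
      using walk_up[of i j] that by simp
    \<comment> \<open>The other way round the cycle: from \<open>j\<close> on through vertex
      \<open>0\<close> to \<open>i\<close>, then reversed.\<close>
    have "walk_cost G w (vs ! j) (vs ! 0) (L - p j)" "walk_cost G w (vs ! 0) (vs ! i) (p i)"
      using walk_up[of j n] walk_up[of 0 i] that by (simp_all add: L_def p_0)
    then have other: "walk_cost G w (vs ! i) (vs ! j) (L - p j + p i)"
      by (rule walk_cost_sym[OF walk_cost_trans])
    have "p i \<le> p j" "p j \<le> L" using that p_mono by (simp_all add: L_def)
    then have "circ_dist L (p i) (p j) = p j - p i \<or> circ_dist L (p i) (p j) = L - p j + p i"
      by (auto simp: circ_dist_def Let_def min_def max_def)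
    then show ?thesis using one other by auto
  qed
  have circ_dist_sym: "circ_dist L x y = circ_dist L y x" for x y
    by (simp add: circ_dist_def max.commute min.commute)
  have D: "distance_fun G w (\<lambda>u v. circ_dist L (q u) (q v))"
    unfolding distance_fun_def
  proof (intro conjI ballI allI impI)
    show "pair_wf_digraph G" by unfold_locales
    show "circ_dist L (q u) (q u) = 0" for u by (simp add: circ_dist_def)
    show "walk_cost G w u v (circ_dist L (q u) (q v))" if uv: "u \<in> pverts G" "v \<in> pverts G" for u v
    proof -
      obtain i j where ij: "i < n" "u = vs ! i" "j < n" "v = vs ! j"
        using vertexE uv by blast
      show ?thesis
      proof (cases "i \<le> j")
        case True
        then show ?thesis using walk_le ij by (simp add: q_nth)
      next
        case False
        then have "walk_cost G w v u (circ_dist L (q v) (q u))"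
          using walk_le[of j i] ij by (simp add: q_nth)
        then show ?thesis using walk_cost_sym circ_dist_sym by simp
      qed
    qed
    show "circ_dist L (q a) (q v) \<le> circ_dist L (q a) (q u) + w (u, v)"
      if a: "a \<in> pverts G" and uv: "(u, v) \<in> parcs G" for a u v
    proof -
      obtain i where i: "i < n"
        and "(u, v) = (vs ! i, vs ! (Suc i mod n)) \<or> (u, v) = (vs ! (Suc i mod n), vs ! i)"
        using arcE[OF uv] by blast
      then have "q u = p i \<and> q v = (if Suc i = n then 0 else p i + W i) \<or>
          q v = p i \<and> q u = (if Suc i = n then 0 else p i + W i)" and "w (u, v) = W i"
        unfolding W_def[of i] using q_nth[OF i] q_next[OF i, unfolded W_def] weight_sym[OF uv]
        by fastforce+
      moreover have "p i + W i \<le> L" "Suc i = n \<Longrightarrow> p i + W i = L"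
        using p_mono[of "Suc i" n] i by (auto simp: p_Suc L_def)
      \<comment> \<open>The closing edge ends at coordinate \<open>0\<close>, which
        \<open>circ_dist_zero\<close> exchanges for \<open>L\<close>, so that it fits the same
        inequalities as the other edges.\<close>
      ultimately show ?thesis
        using circ_dist_add_le[of "p i" "W i" L "q a"] circ_dist_zero[OF q_le[OF a]] q_le[OF a]
        by (auto split: if_splits)
    qed
  qed
  have edge: "circ_dist L (q (vs ! i)) (q (vs ! (Suc i mod n))) = W i" if "i < n" for i
    using weight_minimal[OF arc[OF that]] wdist_eq_distance_fun[OF D] nth_mem[OF that] arc[OF that]
    by (simp add: W_def in_arcsD2)
  \<comment> \<open>The last vertex within half the perimeter, its successor and the starting vertex cut the
    cycle into three arcs, none longer than half the perimeter.\<close>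
  define j where "j = Max {i. i < n \<and> 2 * p i \<le> L}"
  have "j \<in> {i. i < n \<and> 2 * p i \<le> L}"
    unfolding j_def using n by (intro Max_in) (auto intro!: exI[of _ 0] simp: p_0)
  then have j: "j < n" "2 * p j \<le> L" by auto
  \<comment> \<open>By maximality of \<open>j\<close>, unless \<open>j\<close> is the last index;
    then \<open>p (Suc j)\<close> is the whole perimeter.\<close>
  have Suc_j: "L \<le> 2 * p (Suc j)"
  proof (cases "Suc j = n")
    case False
    then have "Suc j \<notin> {i. i < n \<and> 2 * p i \<le> L}"
      using Max_ge[of "{i. i < n \<and> 2 * p i \<le> L}" "Suc j"] by (auto simp flip: j_def)
    with False j show ?thesis by simp
  qed (simp add: L_def)
  have "p (Suc j) \<le> L" using p_mono[of "Suc j" n] j by (simp add: L_def)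
  moreover have "Suc j = n \<Longrightarrow> p (Suc j) = L" by (simp add: L_def)
  \<comment> \<open>Past the half-way point the shorter way back to \<open>0\<close> has length
    \<open>L - p (Suc j)\<close>. If \<open>Suc j = n\<close>, the third vertex is the starting
    vertex and this length is zero.\<close>
  ultimately have "L \<le> p j + W j + circ_dist L (q (vs ! (Suc j mod n))) 0"
    using Suc_j q_next[OF j(1)] by (auto simp: circ_dist_def p_Suc)
  moreover have "circ_dist L (q (vs ! 0)) (q (vs ! j)) = p j"
    using j n by (simp add: q_nth p_0 circ_dist_def)
  moreover have "q (vs ! 0) = 0" using n q_nth p_0 by simp
  ultimately have "L \<le> circ_dist L (q (vs ! 0)) (q (vs ! j))
      + circ_dist L (q (vs ! j)) (q (vs ! (Suc j mod n)))
      + circ_dist L (q (vs ! (Suc j mod n))) (q (vs ! 0))"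
    using edge[OF j(1)] by simp
  then show thesis
    using that[OF D q_le, of "vs ! 0" "vs ! j" "vs ! (Suc j mod n)"] nth_mem j n by simp
qed

text \<open>\<open>graph_beta_eq\<close> applies both to each cycle, with overhead \<open>1\<close>
  from rounding, and to the product, where perimeters and overheads add up; the two resulting values
  are then compared.\<close>

lemma graph_beta_cart_prod_cycles:
  assumes "finite I" and cyc: "\<And>i. i \<in> I \<Longrightarrow> weighted_cycle (C i) (w i)"
  shows "graph_beta (cart_prod I C) (cart_prod_weight I w) = (\<Sum>i\<in>I. graph_beta (C i) (w i))"
proof -
  \<comment> \<open>Bundling the properties allows all witnesses to be chosen simultaneously as
    families over \<open>I\<close>.\<close>
  define R where "R i q L a b c \<longleftrightarrow>
      distance_fun (C i) (w i) (\<lambda>u v. circ_dist L (q u) (q v)) \<and>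
      (\<forall>u\<in>pverts (C i). q u \<le> L) \<and> a \<in> pverts (C i) \<and> b \<in> pverts (C i) \<and> c \<in> pverts (C i) \<and>
      L \<le> circ_dist L (q a) (q b) + circ_dist L (q b) (q c) + circ_dist L (q c) (q a)"
    for i q L a b c
  have "\<exists>q L a b c. R i q L a b c" if "i \<in> I" for i
    by (rule weighted_cycle_distance_fun[OF cyc[OF that]]) (unfold R_def, blast)
  then obtain q L a b c where "\<And>i. i \<in> I \<Longrightarrow> R i (q i) (L i) (a i) (b i) (c i)"
    by metis
  then have D: "\<And>i. i \<in> I \<Longrightarrow> distance_fun (C i) (w i) (\<lambda>u v. circ_dist (L i) (q i u) (q i v))"
    and q: "\<And>i u. i \<in> I \<Longrightarrow> u \<in> pverts (C i) \<Longrightarrow> q i u \<le> L i"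
    and abc: "\<And>i. i \<in> I \<Longrightarrow> a i \<in> pverts (C i)" "\<And>i. i \<in> I \<Longrightarrow> b i \<in> pverts (C i)"
      "\<And>i. i \<in> I \<Longrightarrow> c i \<in> pverts (C i)"
    and per: "\<And>i. i \<in> I \<Longrightarrow> L i \<le> circ_dist (L i) (q i (a i)) (q i (b i))
      + circ_dist (L i) (q i (b i)) (q i (c i)) + circ_dist (L i) (q i (c i)) (q i (a i))"
    unfolding R_def by blast+
  define d where "d i u v = circ_dist (L i) (q i u) (q i v)" for i u v
  have emb: "\<exists>m. 2 * m \<le> l * L i + 1 \<and> embeddable (pverts (C i)) (\<lambda>u v. l * d i u v) m"
    if "i \<in> I" for i l
    unfolding d_def using embeddable_circ_dist q[OF that] by blast
  have single: "graph_beta (C i) (w i) = real (L i) / 2" if "i \<in> I" for i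
    using graph_beta_eq[of "C i" "w i" "d i" "a i" "b i" "c i" "L i" 1]
      D[OF that] abc[OF that] per[OF that] emb[OF that]
    unfolding d_def by blast
  let ?P = "\<Pi>\<^sub>E i\<in>I. pverts (C i)"
  let ?D = "\<lambda>x y. \<Sum>i\<in>I. d i (x i) (y i)"
  have V: "pverts (cart_prod I C) = ?P" by (simp add: cart_prod_def)
  have loopfree: "pair_loopfree_digraph (C i)" if "i \<in> I" for i
  proof -
    interpret weighted_graph "C i" "w i" using cyc[OF that] by (simp add: weighted_cycle_def)
    show ?thesis by unfold_locales
  qed
  have "graph_beta (cart_prod I C) (cart_prod_weight I w) = real (\<Sum>i\<in>I. L i) / 2"
  proof (rule graph_beta_eq)
    show "distance_fun (cart_prod I C) (cart_prod_weight I w) ?D"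
      using assms(1) loopfree D unfolding d_def by (rule distance_fun_cart_prod)
    \<comment> \<open>The diagonal triangle: \<open>a\<close>, \<open>b\<close> and \<open>c\<close>
      collect the chosen vertices of the factors, and restriction makes them extensional
      tuples.\<close>
    show "restrict a I \<in> pverts (cart_prod I C)" "restrict b I \<in> pverts (cart_prod I C)"
      "restrict c I \<in> pverts (cart_prod I C)"
      using abc by (auto simp: V)
    show "(\<Sum>i\<in>I. L i) \<le> ?D (restrict a I) (restrict b I) + ?D (restrict b I) (restrict c I)
        + ?D (restrict c I) (restrict a I)"
      unfolding sum.distrib[symmetric] d_def using per by (intro sum_mono) simp
    fix l
    obtain m where m: "\<And>i. i \<in> I \<Longrightarrow> 2 * m i \<le> l * L i + 1"
      "\<And>i. i \<in> I \<Longrightarrow> embeddable (pverts (C i)) (\<lambda>u v. l * d i u v) (m i)"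
      using emb[of _ l] by metis
    have "2 * (\<Sum>i\<in>I. m i) \<le> l * (\<Sum>i\<in>I. L i) + card I"
      using sum_mono[of I "\<lambda>i. 2 * m i" "\<lambda>i. l * L i + 1"] m(1)
      by (simp add: sum_distrib_left sum_Suc)
    moreover have "embeddable (pverts (cart_prod I C)) (\<lambda>x y. l * ?D x y) (\<Sum>i\<in>I. m i)"
      unfolding V sum_distrib_left by (rule embeddable_prod[OF assms(1) m(2)])
    ultimately show "\<exists>m. 2 * m \<le> l * (\<Sum>i\<in>I. L i) + card I \<and>
        embeddable (pverts (cart_prod I C)) (\<lambda>x y. l * ?D x y) m"
      by blast
  qed
  also have "\<dots> = (\<Sum>i\<in>I. graph_beta (C i) (w i))"
    by (simp only: of_nat_sum sum_divide_distrib single cong: sum.cong)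
  finally show ?thesis .
qed

theorem theorem9:
  fixes k :: nat
    and C :: "nat \<Rightarrow> 'a pair_pre_digraph"
    and w :: "nat \<Rightarrow> 'a \<times> 'a \<Rightarrow> nat"
  assumes "1 \<le> k"
    and "\<And>i. i \<in> {1..k} \<Longrightarrow> weighted_cycle (C i) (w i)"
  shows "graph_beta (cart_prod {1..k} C) (cart_prod_weight {1..k} w)
           = (\<Sum>i=1..k. graph_beta (C i) (w i))"
  using assms(2) by (intro graph_beta_cart_prod_cycles) auto

end
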